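(* Let $m,n\geq 1$ be integers and $1\leq k\leq n$. Then $$\sum_{l_{1},\dots,l_{m-1}=0}^{n}(-1)^{l_{1}+l_{2}+\cdots+l_{m-1}+k}L(n,l_{1})L(l_{1},l_{2})\cdots L(l_{m-1},k)$$ $$=\sum_{\substack{k_{1}+\cdots+k_{m}=n-k\\ k_1,\dots,k_m\geq0}}(-1)^{(n-k_{m})+(n-k_{m}-k_{m-1})+\cdots+(n-k_{m}-\cdots-k_{2})+k}\,\frac{n!}{k!}\binom{n-1}{k_{1},k_{2},\dots,k_{m},k-1}.$$
   Context: $L(n,k)$ are the Lah numbers: $L(n,k)=\binom{n-1}{k-1}\frac{n!}{k!}$ for $1\leq k\leq n$, $L(n,k)=0$ for $k>n$, $L(n,0)=0$ for $n\geq1$, and $L(0,0)=1$. For $m=1$ the left-hand side has no summation indices and is read as $(-1)^kL(n,k)$, and the exponent of $-1$ on the right-hand side reduces to $k$ (the sum $(n-k_m)+\cdots+(n-k_m-\cdots-k_2)$ has $m-1$ terms, the $j$-th being $n-k_m-k_{m-1}-\cdots-k_{m-j+1}$). The multinomial coefficient is $\binom{n-1}{k_1,\dots,k_m,k-1}=\frac{(n-1)!}{k_1!\cdots k_m!\,(k-1)!}$. *)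

theory Defs
  imports Complex_Main
begin

text \<open>
  Lah numbers and multinomial coefficients are real-valued so that the quotients of factorials
  below are exact divisions.
\<close>

definition lah :: "nat \<Rightarrow> nat \<Rightarrow> real" where
  "lah n k =
     (if n = 0 \<and> k = 0 then 1
      else if 1 \<le> k \<and> k \<le> n then real ((n - 1) choose (k - 1)) * (fact n / fact k)
      else 0)"

text \<open>
  The lower entries are given as a list. The quotient is the multinomial coefficient only when
  they add up to \<open>n\<close>; no convention is imposed otherwise.
\<close>

definition multinomial :: "nat \<Rightarrow> nat list \<Rightarrow> real" where
  "multinomial n ks = fact n / (\<Prod>k\<leftarrow>ks. fact k)"

definition tuples :: "nat \<Rightarrow> nat \<Rightarrow> nat list set" where
  "tuples r n = {ls. length ls = r \<and> set ls \<subseteq> {0..n}}"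

definition weak_compositions :: "nat \<Rightarrow> nat \<Rightarrow> nat list set" where
  "weak_compositions m s = {ks. length ks = m \<and> sum_list ks = s}"

text \<open>
  Both index sets are finite, so sums over them do not collapse to the default value 0.
\<close>

lemma finite_tuples: "finite (tuples r n)"
  using finite_lists_length_eq[of "{0..n}" r] by (simp add: tuples_def conj_commute)

lemma finite_weak_compositions: "finite (weak_compositions m s)"
proof (rule finite_subset[OF _ finite_tuples])
  show "weak_compositions m s \<subseteq> tuples m s"
    using member_le_sum_list by (fastforce simp: weak_compositions_def tuples_def)
qed

text \<open>
  For \<open>ls = [l\<^sub>1, \<dots>, l\<^sub>r]\<close> this is \<open>L(n, l\<^sub>1) L(l\<^sub>1, l\<^sub>2) \<cdots> L(l\<^sub>r, k)\<close>, and \<open>L(n, k)\<close> if \<open>r = 0\<close>.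
\<close>

definition lah_chain :: "nat \<Rightarrow> nat list \<Rightarrow> nat \<Rightarrow> real" where
  "lah_chain n ls k =
     (let c = n # ls @ [k] in \<Prod>i\<le>length ls. lah (c ! i) (c ! Suc i))"

text \<open>
  For \<open>ks = [k\<^sub>1, \<dots>, k\<^sub>m]\<close> the \<open>j\<close>-th summand is \<open>n - k\<^sub>m - k\<^bsub>m-1\<^esub> - \<cdots> - k\<^bsub>m-j+1\<^esub>\<close>; the
  subtraction does not truncate when \<open>sum_list ks \<le> n\<close>.
\<close>

definition sign_exponent :: "nat \<Rightarrow> nat list \<Rightarrow> nat" where
  "sign_exponent n ks =
     (\<Sum>j = 1..length ks - 1. n - sum_list (drop (length ks - j) ks))"

end

theory Submission
  imports Defs
begin

text \<open>
  Nonzero summands on the left belong to chains \<open>n \<ge> l\<^sub>1 \<ge> \<cdots> \<ge> l\<^bsub>m-1\<^esub> \<ge> k\<close>, and these correspond to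
  the weak compositions of \<open>n - k\<close> by taking successive differences, with \<open>k\<^sub>m = n - l\<^sub>1\<close>. The two
  sums satisfy the same recursion, obtained by splitting off \<open>l\<^sub>1\<close>, respectively \<open>k\<^sub>m\<close>.
\<close>

lemma lah_chain_Nil [simp]: "lah_chain n [] k = lah n k"
  by (simp add: lah_chain_def)

lemma lah_chain_Cons [simp]: "lah_chain n (l # ls) k = lah n l * lah_chain l ls k"
  by (simp add: lah_chain_def Let_def prod.atMost_Suc_shift del: prod.atMost_Suc)

text \<open>A factor \<open>lah a b\<close> with \<open>a < b\<close> vanishes, so a nonzero chain
  descends weakly and cannot end above its start.\<close>

lemma lah_chain_eq_0: "n < k \<Longrightarrow> lah_chain n ls k = 0"
proof (induction ls arbitrary: n)
  case Nil
  then show ?case by (simp add: lah_def)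
next
  case (Cons l ls)
  show ?case
  proof (cases "l \<le> n")
    case True
    with Cons show ?thesis by simp
  next
    case False
    then show ?thesis by (simp add: lah_def)
  qed
qed

text \<open>The first summand involves only the suffix \<open>[a]\<close>; every later suffix
  contains \<open>a\<close>, which can be absorbed into the starting value. For
  \<open>ks = []\<close> there is no first summand, and the right-hand side would be
  \<open>n - a\<close> instead of 0.\<close>

lemma sign_exponent_snoc:
  assumes "ks \<noteq> []"
  shows "sign_exponent n (ks @ [a]) = (n - a) + sign_exponent (n - a) ks"
proof -
  have "sign_exponent n (ks @ [a])
      = (\<Sum>j = Suc 0..Suc (length ks - 1). n - sum_list (drop (Suc (length ks) - j) (ks @ [a])))"
    using assms by (simp add: sign_exponent_def)
  also have "\<dots> = (n - a)
      + (\<Sum>j = Suc (Suc 0)..Suc (length ks - 1). n - sum_list (drop (Suc (length ks) - j) (ks @ [a])))"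
    by (subst sum.atLeast_Suc_atMost) auto
  also have "(\<Sum>j = Suc (Suc 0)..Suc (length ks - 1). n - sum_list (drop (Suc (length ks) - j) (ks @ [a])))
      = (\<Sum>j = 1..length ks - 1. n - a - sum_list (drop (length ks - j) ks))"
    by (subst sum.shift_bounds_cl_Suc_ivl) (auto intro!: sum.cong simp: add.commute)
  finally show ?thesis by (simp add: sign_exponent_def)
qed

lemma sum_tuples_Suc:
  "(\<Sum>ls\<in>tuples (Suc r) N. f ls) = (\<Sum>l\<le>N. \<Sum>ls\<in>tuples r N. f (l # ls))"
proof -
  have "(\<Sum>ls\<in>tuples (Suc r) N. f ls) = (\<Sum>(l, ls)\<in>{..N} \<times> tuples r N. f (l # ls))"
    by (rule sum.reindex_bij_witness[where i = "\<lambda>(l, ls). l # ls" and j = "\<lambda>ls. (hd ls, tl ls)"])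
      (auto simp: tuples_def length_Suc_conv)
  then show ?thesis by (simp add: sum.cartesian_product)
qed

lemma sum_weak_compositions_Suc:
  "(\<Sum>ks\<in>weak_compositions (Suc m) s. f ks)
    = (\<Sum>a\<le>s. \<Sum>ks\<in>weak_compositions m (s - a). f (ks @ [a]))"
proof -
  have "(\<Sum>ks\<in>weak_compositions (Suc m) s. f ks)
      = (\<Sum>(a, ks)\<in>Sigma {..s} (\<lambda>a. weak_compositions m (s - a)). f (ks @ [a]))"
    by (rule sum.reindex_bij_witness
        [where i = "\<lambda>(a, ks). ks @ [a]" and j = "\<lambda>ks. (last ks, butlast ks)"])
      (auto simp: weak_compositions_def length_Suc_conv_rev)
  then show ?thesis by (simp add: sum.Sigma finite_weak_compositions)
qed

text \<open>Written in factorials, the binomial in \<open>lah n l\<close> cancels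
  \<open>fact (l - 1)\<close> and leaves \<open>fact (n - l)\<close> in the denominator as a new
  lower entry.\<close>

lemma lah_mult_multinomial:
  assumes "1 \<le> l" "l \<le> n"
  shows "lah n l * (fact l / fact k * multinomial (l - 1) ks)
    = fact n / fact k * multinomial (n - 1) (ks @ [n - l])"
proof -
  have "real ((n - 1) choose (l - 1)) = fact (n - 1) / (fact (l - 1) * fact (n - l))"
    using assms by (subst binomial_fact) auto
  with assms show ?thesis by (simp add: lah_def multinomial_def mult_ac)
qed

lemma multinomial_swap: "multinomial n (ks @ [a, b]) = multinomial n (ks @ [b, a])"
  by (simp add: multinomial_def mult_ac)

text \<open>
  The range \<open>N\<close> of the indices is decoupled from \<open>n\<close>, as it stays fixed when \<open>l\<^sub>1\<close> takes the place
  of \<open>n\<close>.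
\<close>

lemma sum_tuples_lah_chain:
  assumes "1 \<le> k" "k \<le> n" "n \<le> N"
  shows "(\<Sum>ls\<in>tuples r N. (-1) ^ (sum_list ls + k) * lah_chain n ls k) =
         (\<Sum>ks\<in>weak_compositions (Suc r) (n - k).
            (-1) ^ (sign_exponent n ks + k) * (fact n / fact k) * multinomial (n - 1) (ks @ [k - 1]))"
  using assms
proof (induction r arbitrary: n)
  case 0
  have "tuples 0 N = {[]}" "weak_compositions (Suc 0) (n - k) = {[n - k]}"
    by (auto simp: tuples_def weak_compositions_def length_Suc_conv)
  \<comment> \<open>This is the case \<open>l = k\<close> of the product rule, where the inner
    multinomial coefficient is 1.\<close>
  moreover have "lah n k = fact n / fact k * multinomial (n - 1) [n - k, k - 1]"
    using lah_mult_multinomial[of k n k "[k - 1]"] 0 multinomial_swap[of "n - 1" "[]"]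
    by (simp add: multinomial_def)
  ultimately show ?case by (simp add: sign_exponent_def)
next
  case (Suc r)
  let ?S = "\<lambda>l. \<Sum>ls\<in>tuples r N. (-1) ^ (sum_list ls + k) * lah_chain l ls k"
  let ?t = "\<lambda>n ks. (-1) ^ (sign_exponent n ks + k) * (fact n / fact k) * multinomial (n - 1) (ks @ [k - 1])"
  \<comment> \<open>Termwise matching under \<open>l = n - a\<close>, with \<open>a\<close> the last
    part: the sign of \<open>l\<close> supplies the leading summand \<open>n - a\<close> of the
    exponent. The new part lands behind \<open>k - 1\<close>, hence the swap.\<close>
  have step: "(-1) ^ l * lah n l * ?t l ks = ?t n (ks @ [n - l])"
    if "l \<in> {k..n}" "ks \<in> weak_compositions (Suc r) (l - k)" for l ks
  proof -
    from that have "ks \<noteq> []" by (auto simp: weak_compositions_def)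
    then have sign: "sign_exponent n (ks @ [n - l]) = l + sign_exponent l ks"
      using that by (simp add: sign_exponent_snoc)
    have "(-1) ^ l * lah n l * ?t l ks = (-1) ^ (l + sign_exponent l ks + k)
        * (lah n l * (fact l / fact k * multinomial (l - 1) (ks @ [k - 1])))"
      by (simp add: power_add)
    also have "\<dots> = ?t n (ks @ [n - l])"
      using that Suc.prems by (subst lah_mult_multinomial) (auto simp: sign multinomial_swap)
    finally show ?thesis .
  qed
  have "(\<Sum>ls\<in>tuples (Suc r) N. (-1) ^ (sum_list ls + k) * lah_chain n ls k)
      = (\<Sum>l\<le>N. (-1) ^ l * lah n l * ?S l)"
    by (simp add: sum_tuples_Suc sum_distrib_left power_add mult_ac)
  \<comment> \<open>For \<open>l < k\<close> the inner sum vanishes, for \<open>l > n\<close> the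
    factor \<open>lah n l\<close> does. On the remaining range the induction hypothesis
    applies.\<close>
  also have "\<dots> = (\<Sum>l\<in>{k..n}. (-1) ^ l * lah n l * ?S l)"
  proof (rule sum.mono_neutral_right)
    show "\<forall>l\<in>{..N} - {k..n}. (-1) ^ l * lah n l * ?S l = 0"
    proof
      fix l assume "l \<in> {..N} - {k..n}"
      then consider "l < k" | "n < l" by force
      then show "(-1) ^ l * lah n l * ?S l = 0"
        by cases (simp_all add: lah_chain_eq_0 lah_def)
    qed
  qed (use Suc.prems in auto)
  also have "\<dots> = (\<Sum>l\<in>{k..n}. \<Sum>ks\<in>weak_compositions (Suc r) (l - k). ?t n (ks @ [n - l]))"
  proof (rule sum.cong[OF refl])
    fix l assume l: "l \<in> {k..n}"
    then have "?S l = (\<Sum>ks\<in>weak_compositions (Suc r) (l - k). ?t l ks)"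
      using Suc.prems by (intro Suc.IH) auto
    then show "(-1) ^ l * lah n l * ?S l
        = (\<Sum>ks\<in>weak_compositions (Suc r) (l - k). ?t n (ks @ [n - l]))"
      by (simp only: sum_distrib_left step[OF l] cong: sum.cong)
  qed
  \<comment> \<open>Substituting \<open>a = n - l\<close> turns the remaining total
    \<open>l - k\<close> into \<open>n - k - a\<close>.\<close>
  also have "\<dots> = (\<Sum>a\<le>n - k. \<Sum>ks\<in>weak_compositions (Suc r) (n - k - a). ?t n (ks @ [a]))"
    by (rule sum.reindex_bij_witness[where i = "\<lambda>a. n - a" and j = "\<lambda>l. n - l"])
      (use Suc.prems in \<open>auto simp: diff_commute\<close>)
  also have "\<dots> = (\<Sum>ks\<in>weak_compositions (Suc (Suc r)) (n - k). ?t n ks)"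
    by (rule sum_weak_compositions_Suc[symmetric])
  finally show ?case .
qed

theorem theorem2:
  fixes m n k :: nat
  assumes "1 \<le> m" and "1 \<le> n" and "1 \<le> k" and "k \<le> n"
  shows "(\<Sum>ls\<in>tuples (m - 1) n. (-1) ^ (sum_list ls + k) * lah_chain n ls k) =
         (\<Sum>ks\<in>weak_compositions m (n - k).
            (-1) ^ (sign_exponent n ks + k) * (fact n / fact k) * multinomial (n - 1) (ks @ [k - 1]))"
  using sum_tuples_lah_chain[of k n n "m - 1"] assms by simp

end
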